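(* Let $f,g:\{0,1\}^n\to\{0,1\}$ be Boolean functions. If $f$ is PN-equivalent to $g$, then $f$ and $g$ have the same ordered influence vector: $OIV(f)=OIV(g)$.
   Context: For a word $X=(x_1,\dots,x_n)\in\{0,1\}^n$, $X^i$ denotes $X$ with its $i$-th bit negated. A selective negation $(\neg)$ is a map $\{0,1\}^n\to\{0,1\}^n$ that negates the bits in some fixed set of positions and leaves the others unchanged. A permutation $\pi$ acts on words by reordering their entries. $f$ is PN-equivalent to $g$ if there are a permutation $\pi$ and a selective negation $(\neg)$ with $f(\pi((\neg)X))=g(X)$ for all $X\in\{0,1\}^n$. The influence of input $i$ on $f$ is (with the normalization used here) $inf(f,i)=\frac12\,|\{X\in\{0,1\}^n : f(X)\neq f(X^i)\}|$. The ordered influence vector is $OIV(f)=\{inf(f,i): i\in\{1,\dots,n\}\}_\le$, where $\{\cdot\}_\le$ denotes the multiset (with multiplicities) listed in non-decreasing order. *)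

theory Defs
  imports Complex_Main "HOL-Library.Multiset" "HOL-Combinatorics.Permutations"
begin

(* Bits are booleans and positions are numbered 0, ..., n - 1.  A Boolean function of arity n
   is a function on bool lists of which only the values on words n are ever used. *)

definition words :: "nat \<Rightarrow> bool list set" where
  "words n = {X. length X = n}"

definition flip :: "nat \<Rightarrow> bool list \<Rightarrow> bool list" where
  "flip i X = X[i := \<not> X ! i]"

definition selective_negation :: "nat set \<Rightarrow> bool list \<Rightarrow> bool list" where
  "selective_negation S X = map (\<lambda>i. if i \<in> S then \<not> X ! i else X ! i) [0..<length X]"

(* permute_list p (x_0, ..., x_(n-1)) = (x_(p 0), ..., x_(p (n-1))) *)
definition PN_equivalent :: "nat \<Rightarrow> (bool list \<Rightarrow> bool) \<Rightarrow> (bool list \<Rightarrow> bool) \<Rightarrow> bool" where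
  "PN_equivalent n f g \<longleftrightarrow>
    (\<exists>p S. p permutes {..<n} \<and> S \<subseteq> {..<n} \<and>
      (\<forall>X\<in>words n. f (permute_list p (selective_negation S X)) = g X))"

definition influence :: "nat \<Rightarrow> (bool list \<Rightarrow> bool) \<Rightarrow> nat \<Rightarrow> real" where
  "influence n f i = 1 / 2 * real (card {X \<in> words n. f X \<noteq> f (flip i X)})"

definition OIV :: "nat \<Rightarrow> (bool list \<Rightarrow> bool) \<Rightarrow> real list" where
  "OIV n f = sorted_list_of_multiset {# influence n f i. i \<in># mset_set {..<n} #}"

end

(* If T X = permute_list p (selective_negation S X), then T is a bijection of the words of
   length n with T (flip (p i) X) = flip i (T X).  Hence T carries the words at which input p i
   matters for g = f o T to those at which input i matters for f, and the influences of f and g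
   agree up to reindexing by p. *)
theory Submission
  imports Defs
begin

definition PN_map :: "(nat \<Rightarrow> nat) \<Rightarrow> nat set \<Rightarrow> bool list \<Rightarrow> bool list" where
  "PN_map p S X = permute_list p (selective_negation S X)"

lemma length_PN_map [simp]: "length (PN_map p S X) = length X"
  by (simp add: PN_map_def selective_negation_def)

text \<open>The negation acts before the permutation, so the bit arriving at position
  \<open>i\<close> is negated according to whether its source \<open>p i\<close>, not
  \<open>i\<close> itself, lies in \<open>S\<close>. On booleans, \<open>\<noteq>\<close> is
  exclusive or.\<close>

lemma nth_PN_map:
  assumes "p permutes {..<length X}" and "i < length X"
  shows "PN_map p S X ! i = (X ! p i \<noteq> (p i \<in> S))"
proof -
  have "p i < length X"
    using permutes_in_image[OF assms(1), of i] assms(2) by simp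
  then show ?thesis
    using assms by (simp add: PN_map_def permute_list_nth selective_negation_def)
qed

text \<open>Bit \<open>i\<close> of the image reads only bit \<open>p i\<close> of \<open>X\<close>,
  and injectivity of \<open>p\<close> ensures that no other bit of the image reads it.\<close>

lemma PN_map_flip:
  assumes "p permutes {..<length X}" and "i < length X"
  shows "PN_map p S (flip (p i) X) = flip i (PN_map p S X)"
proof (rule nth_equalityI)
  show "length (PN_map p S (flip (p i) X)) = length (flip i (PN_map p S X))"
    by (simp add: flip_def)
next
  fix j assume "j < length (PN_map p S (flip (p i) X))"
  then have j: "j < length X" by (simp add: flip_def)
  have "p k < length X" if "k < length X" for k
    using permutes_in_image[OF assms(1), of k] that by simp
  moreover have "p i = p j \<longleftrightarrow> i = j"
    using permutes_inj[OF assms(1)] by (auto dest: injD)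
  ultimately show "PN_map p S (flip (p i) X) ! j = flip i (PN_map p S X) ! j"
    using assms j nth_PN_map[of p "flip (p i) X" j S] nth_PN_map[of p X j S]
    by (auto simp: flip_def nth_list_update)
qed

lemma finite_words: "finite (words n)"
  using finite_lists_length_eq[of "UNIV :: bool set" n] by (simp add: words_def)

text \<open>Every position is some \<open>p i\<close>, so the image determines each bit of the word;
  this gives injectivity. Surjectivity then follows because \<open>words n\<close> is finite and
  mapped into itself.\<close>

lemma bij_betw_PN_map:
  assumes p: "p permutes {..<n}"
  shows "bij_betw (PN_map p S) (words n) (words n)"
proof -
  have "inj_on (PN_map p S) (words n)"
  proof (rule inj_onI)
    fix X Y assume "X \<in> words n" "Y \<in> words n" and eq: "PN_map p S X = PN_map p S Y"
    then have len: "length X = n" "length Y = n" by (simp_all add: words_def)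
    show "X = Y"
    proof (rule nth_equalityI)
      fix j assume "j < length X"
      then obtain i where "i < n" "j = p i"
        using permutes_image[OF p] len by (metis imageE lessThan_iff)
      then show "X ! j = Y ! j"
        using nth_PN_map[of p X i S] nth_PN_map[of p Y i S] p len eq by auto
    qed (simp add: len)
  qed
  moreover have "PN_map p S ` words n \<subseteq> words n"
    by (auto simp: words_def)
  ultimately show ?thesis
    using endo_inj_surj[OF finite_words] by (simp add: bij_betw_def)
qed

lemma influence_PN_map:
  assumes p: "p permutes {..<n}" and i: "i < n"
    and fg: "\<And>X. X \<in> words n \<Longrightarrow> f (PN_map p S X) = g X"
  shows "influence n g (p i) = influence n f i"
proof -
  have "g X \<noteq> g (flip (p i) X) \<longleftrightarrow> f (PN_map p S X) \<noteq> f (flip i (PN_map p S X))"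
    if "X \<in> words n" for X
  proof -
    \<comment> \<open>The hypothesis relating \<open>f\<close> and \<open>g\<close> covers only
      \<open>words n\<close>, and it is applied to the flipped word as well as to
      \<open>X\<close>.\<close>
    have "flip (p i) X \<in> words n"
      using that by (simp add: words_def flip_def)
    then show ?thesis
      using that p i fg[of X] fg[of "flip (p i) X"] PN_map_flip[of p X i S]
      by (simp add: words_def)
  qed
  then have "bij_betw (PN_map p S) {X \<in> words n. g X \<noteq> g (flip (p i) X)}
      {Y \<in> words n. f Y \<noteq> f (flip i Y)}"
    by (intro bij_betw_Collect[OF bij_betw_PN_map[OF p]]) blast
  then show ?thesis
    by (simp add: influence_def bij_betw_same_card)
qed

theorem theorem1:
  fixes n :: nat and f g :: "bool list \<Rightarrow> bool"
  assumes "PN_equivalent n f g"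
  shows "OIV n f = OIV n g"
proof -
  from assms obtain p S where p: "p permutes {..<n}"
    and fg: "\<And>X. X \<in> words n \<Longrightarrow> f (PN_map p S X) = g X"
    by (auto simp: PN_equivalent_def PN_map_def)
  have "image_mset (influence n f) (mset_set {..<n})
      = image_mset (\<lambda>i. influence n g (p i)) (mset_set {..<n})"
    by (rule image_mset_cong) (simp add: influence_PN_map[where f = f and g = g and S = S] p fg)
  also have "\<dots> = image_mset (influence n g) (image_mset p (mset_set {..<n}))"
    by (simp add: multiset.map_comp comp_def)
  \<comment> \<open>Reindexing by \<open>p\<close> merely rearranges the positions, so the multiset
    of influences, and with it the sorted list, is unchanged.\<close>
  also have "image_mset p (mset_set {..<n}) = mset_set {..<n}"
    using p by (simp add: image_mset_mset_set permutes_inj_on permutes_image)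
  finally show ?thesis
    by (simp add: OIV_def)
qed

end
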